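(* (Unimodality) Let $0<q<p<1$ with $p+q\neq 1$. Then the set of integers $n\ge 1$ such that 1. $f(n)\ge f(n-1)$, and 2. $f(n+1)\le f(n)$, and 3. at least one of the two inequalities in 1 and 2 is strict, consists either of exactly one integer or of exactly two consecutive integers.
   Context: For an integer $n\ge 0$ and $0<q<p<1$, $$f(n)=f(n,p,q)=\sum_{r\ge 0}\binom{n}{r}p^r(1-p)^{n-r}\sum_{s>r}\binom{n}{s}q^s(1-q)^{n-s},$$ the probability that, when Alice tosses a coin with heads probability $q$ and Bob a coin with heads probability $p$, each $n$ times independently, Alice gets strictly more heads than Bob. *)

theory Defs
  imports Complex_Main
begin

text \<open>
  Alice's coin has heads probability \<open>q\<close>, Bob's has heads probability \<open>p\<close>.
  Both sums stop at \<open>n\<close> because the omitted terms contain a vanishing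
  binomial coefficient.
\<close>

definition f :: "nat \<Rightarrow> real \<Rightarrow> real \<Rightarrow> real" where
  "f n p q =
     (\<Sum>r\<le>n. real (n choose r) * p ^ r * (1 - p) ^ (n - r) *
        (\<Sum>s\<in>{r<..n}. real (n choose s) * q ^ s * (1 - q) ^ (n - s)))"

end

theory Submission
  imports Defs "HOL-Analysis.Convex"
begin

text \<open>
  Let \<open>D\<close> be Alice's number of heads minus Bob's after \<open>n\<close> tosses each, so that
  \<open>f n p q\<close> is the probability of \<open>D \<ge> 1\<close>. One further round changes \<open>D\<close> by at most
  one, and only the states \<open>D = 0\<close> and \<open>D = 1\<close> can cross the threshold; hence
  \<open>f (n + 1) p q - f n p q = q (1 - p) P(D = 0) - p (1 - q) P(D = 1)\<close>
  (\<open>f_increment\<close>), and the sign of the increment is decided by the ratio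
  \<open>P(D = 1) / P(D = 0)\<close>.

  Write \<open>t\<close> for the product of the two odds \<open>p / (1 - p)\<close> and \<open>q / (1 - q)\<close>. Up to positive
  factors whose quotient is independent of \<open>n\<close>, \<open>P(D = 0)\<close> and \<open>P(D = 1)\<close> are the sums
  \<open>G\<^sub>k = \<Sum>r. (n choose r) (n choose (r + k)) t ^ r\<close> for \<open>k = 0\<close> and \<open>k = 1\<close>. The
  heart of the proof is that \<open>G\<^sub>1 / G\<^sub>0\<close> is strictly increasing in \<open>n\<close>
  (\<open>binom_corr_ratio_strict_mono\<close>). By Pascal's rule this amounts to
  \<open>2 t G\<^sub>1\<^sup>2 < G\<^sub>0 (G\<^sub>0 + t G\<^sub>2)\<close>. Now \<open>t\<^bsup>k/2\<^esup> G\<^sub>k\<close> is the autocorrelation at lag \<open>k\<close> of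
  the sequence \<open>v r = (n choose r) t\<^bsup>r/2\<^esup>\<close>, and the inequality is Cauchy--Schwarz for \<open>v\<close>
  and the sum of its two unit shifts (\<open>autocorrelation_inequality\<close>).

  Consequently, once an increment of \<open>f\<close> is at most zero, all later ones are strictly negative.
  The first increment is positive, and \<open>f\<close> tends to \<open>0\<close> because \<open>D\<close> has negative drift
  (\<open>f_tendsto_0\<close>), so the increments do change sign. At most one of them vanishes, namely the
  first nonpositive one, and this decides between one peak and two adjacent peaks.
\<close>

section \<open>Autocorrelations of a finitely supported sequence\<close>

lemma sum_atMost_shift_vanishing:
  fixes h :: "nat \<Rightarrow> real"
  assumes "h (Suc n) = 0"
  shows "(\<Sum>r\<le>n. h (Suc r)) = (\<Sum>r\<le>n. h r) - h 0"
  using sum.atMost_Suc_shift[of h n] assms by simp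

text \<open>
  This is Cauchy--Schwarz for \<open>v\<close> and \<open>y r = v (r - 1) + v (r + 1)\<close>: the inner product of the
  two is twice the lag-one autocorrelation, and on the integers the squared norm of \<open>y\<close> is
  twice the sum of the autocorrelations at lags zero and two. Summing over
  the naturals instead drops the term \<open>(v 0)\<^sup>2\<close> of \<open>y\<close> at index \<open>- 1\<close>, and this loss
  makes the inequality strict.
\<close>

lemma autocorrelation_inequality:
  fixes v :: "nat \<Rightarrow> real"
  assumes supp: "\<And>r. n < r \<Longrightarrow> v r = 0" and "v 0 \<noteq> 0"
  shows "2 * (\<Sum>r\<le>n. v r * v (r + 1))\<^sup>2
       < (\<Sum>r\<le>n. (v r)\<^sup>2) * ((\<Sum>r\<le>n. (v r)\<^sup>2) + (\<Sum>r\<le>n. v r * v (r + 2)))"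
proof -
  define A where "A = (\<Sum>r\<le>n. (v r)\<^sup>2)"
  define B where "B = (\<Sum>r\<le>n. v r * v (r + 1))"
  define C where "C = (\<Sum>r\<le>n. v r * v (r + 2))"
  define y where "y r = (if r = 0 then 0 else v (r - 1)) + v (r + 1)" for r
  \<comment> \<open>The range reaches \<open>Suc n\<close> because the right shift of \<open>v\<close> is supported up to there.\<close>
  have inner: "(\<Sum>r\<le>Suc n. v r * y r) = 2 * B"
  proof -
    have "(\<Sum>r\<le>Suc n. v r * y r) = v 0 * v 1 + (\<Sum>r\<le>n. v (Suc r) * (v r + v (Suc (Suc r))))"
      unfolding sum.atMost_Suc_shift[of _ n] by (simp add: y_def)
    also have "(\<Sum>r\<le>n. v (Suc r) * (v r + v (Suc (Suc r))))
             = B + (\<Sum>r\<le>n. v (Suc r) * v (Suc (Suc r)))"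
      by (simp add: B_def algebra_simps sum.distrib)
    also have "(\<Sum>r\<le>n. v (Suc r) * v (Suc (Suc r))) = B - v 0 * v 1"
      using sum_atMost_shift_vanishing[of "\<lambda>r. v r * v (Suc r)" n] supp by (simp add: B_def)
    finally show ?thesis by simp
  qed
  have norm_v: "(\<Sum>r\<le>Suc n. (v r)\<^sup>2) = A"
    using supp[of "Suc n"] by (simp add: A_def)
  have norm_y: "(\<Sum>r\<le>Suc n. (y r)\<^sup>2) = 2 * (A + C) - (v 0)\<^sup>2"
  proof -
    have "(\<Sum>r\<le>Suc n. (y r)\<^sup>2) = (v 1)\<^sup>2 + (\<Sum>r\<le>n. (v r + v (Suc (Suc r)))\<^sup>2)"
      unfolding sum.atMost_Suc_shift[of _ n] by (simp add: y_def)
    also have "(\<Sum>r\<le>n. (v r + v (Suc (Suc r)))\<^sup>2)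
             = A + 2 * C + (\<Sum>r\<le>n. (v (Suc (Suc r)))\<^sup>2)"
      by (simp add: A_def C_def power2_sum sum.distrib sum_distrib_left algebra_simps)
    also have "(\<Sum>r\<le>n. (v (Suc (Suc r)))\<^sup>2) = A - (v 0)\<^sup>2 - (v 1)\<^sup>2"
      using sum_atMost_shift_vanishing[of "\<lambda>r. (v (Suc r))\<^sup>2" n]
        sum_atMost_shift_vanishing[of "\<lambda>r. (v r)\<^sup>2" n] supp by (simp add: A_def)
    finally show ?thesis by simp
  qed
  have "(2 * B)\<^sup>2 \<le> A * (2 * (A + C) - (v 0)\<^sup>2)"
    using Cauchy_Schwarz_ineq_sum[of v y "{..Suc n}"] unfolding inner norm_v norm_y .
  moreover have "A \<ge> (v 0)\<^sup>2"
    unfolding A_def by (rule member_le_sum) auto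
  hence "A > 0" using \<open>v 0 \<noteq> 0\<close> by (meson less_le_trans zero_less_power2)
  ultimately have "(2 * B)\<^sup>2 < A * (2 * (A + C))"
    using \<open>v 0 \<noteq> 0\<close> by (smt (verit) mult_strict_left_mono zero_less_power2)
  hence "2 * (2 * B\<^sup>2) < 2 * (A * (A + C))" by (simp add: power2_eq_square algebra_simps)
  hence "2 * B\<^sup>2 < A * (A + C)" by linarith
  thus ?thesis by (simp only: A_def B_def C_def)
qed

section \<open>Weighted sums of products of binomial coefficients\<close>

text \<open>
  Up to the factor \<open>t powr (k / 2)\<close>, this is the autocorrelation at lag \<open>k\<close> of
  \<open>(n choose r) * t powr (r / 2)\<close>. Leaving that factor out avoids square roots in
  the recurrences.
\<close>

definition binom_corr :: "real \<Rightarrow> nat \<Rightarrow> nat \<Rightarrow> real" where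
  "binom_corr t k n = (\<Sum>r\<le>n. real (n choose r) * real (n choose (r + k)) * t ^ r)"

lemma binom_corr_0_pos: "t > 0 \<Longrightarrow> binom_corr t 0 n > 0"
  unfolding binom_corr_def by (rule sum_pos) auto

lemma binom_corr_0_Suc:
  "binom_corr t 0 (Suc n) = (1 + t) * binom_corr t 0 n + 2 * t * binom_corr t 1 n"
proof -
  let ?C = "\<lambda>r. real (n choose r)"
  have "binom_corr t 0 (Suc n) = 1 + (\<Sum>r\<le>n. (?C r + ?C (Suc r))\<^sup>2 * t ^ Suc r)"
    unfolding binom_corr_def sum.atMost_Suc_shift[of _ n] by (simp add: power2_eq_square)
  also have "(\<Sum>r\<le>n. (?C r + ?C (Suc r))\<^sup>2 * t ^ Suc r)
      = t * binom_corr t 0 n + 2 * t * binom_corr t 1 n + (\<Sum>r\<le>n. (?C (Suc r))\<^sup>2 * t ^ Suc r)"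
    by (simp add: binom_corr_def power2_eq_square sum.distrib sum_distrib_left algebra_simps)
  also have "(\<Sum>r\<le>n. (?C (Suc r))\<^sup>2 * t ^ Suc r) = binom_corr t 0 n - 1"
    using sum_atMost_shift_vanishing[of "\<lambda>r. (?C r)\<^sup>2 * t ^ r" n]
    by (simp add: binom_corr_def power2_eq_square)
  finally show ?thesis by (simp add: algebra_simps)
qed

lemma binom_corr_1_Suc:
  "binom_corr t 1 (Suc n)
     = (1 + t) * binom_corr t 1 n + binom_corr t 0 n + t * binom_corr t 2 n"
proof -
  let ?C = "\<lambda>r. real (n choose r)"
  have "binom_corr t 1 (Suc n) = 1 + ?C 1 +
      (\<Sum>r\<le>n. (?C r + ?C (Suc r)) * (?C (Suc r) + ?C (Suc (Suc r))) * t ^ Suc r)"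
    unfolding binom_corr_def sum.atMost_Suc_shift[of _ n] by simp
  also have "(\<Sum>r\<le>n. (?C r + ?C (Suc r)) * (?C (Suc r) + ?C (Suc (Suc r))) * t ^ Suc r)
      = t * binom_corr t 1 n + t * binom_corr t 2 n + (\<Sum>r\<le>n. (?C (Suc r))\<^sup>2 * t ^ Suc r)
        + (\<Sum>r\<le>n. ?C (Suc r) * ?C (Suc (Suc r)) * t ^ Suc r)"
    by (simp add: binom_corr_def power2_eq_square sum.distrib sum_distrib_left algebra_simps)
  also have "(\<Sum>r\<le>n. (?C (Suc r))\<^sup>2 * t ^ Suc r) = binom_corr t 0 n - 1"
    using sum_atMost_shift_vanishing[of "\<lambda>r. (?C r)\<^sup>2 * t ^ r" n]
    by (simp add: binom_corr_def power2_eq_square)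
  also have "(\<Sum>r\<le>n. ?C (Suc r) * ?C (Suc (Suc r)) * t ^ Suc r) = binom_corr t 1 n - ?C 1"
    using sum_atMost_shift_vanishing[of "\<lambda>r. ?C r * ?C (Suc r) * t ^ r" n]
    by (simp add: binom_corr_def)
  finally show ?thesis by (simp add: algebra_simps)
qed

text \<open>
  After the recurrences are inserted, the products \<open>(1 + t) G\<^sub>0 G\<^sub>1\<close> cancel. What is left is
  \<open>autocorrelation_inequality\<close> for \<open>v r = (n choose r) (sqrt t) ^ r\<close>.
\<close>

lemma binom_corr_ratio_strict_mono:
  assumes "t > 0"
  shows "binom_corr t 1 n * binom_corr t 0 (Suc n) < binom_corr t 1 (Suc n) * binom_corr t 0 n"
proof -
  define x where "x = sqrt t"
  define v where "v r = real (n choose r) * x ^ r" for r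
  have x: "x * x = t" using assms by (simp add: x_def)
  have corr: "(\<Sum>r\<le>n. v r * v (r + k)) = x ^ k * binom_corr t k n" for k
    by (simp add: v_def binom_corr_def sum_distrib_left power_add power_mult_distrib
        algebra_simps flip: x)
  have "2 * (\<Sum>r\<le>n. v r * v (r + 1))\<^sup>2
       < (\<Sum>r\<le>n. (v r)\<^sup>2) * ((\<Sum>r\<le>n. (v r)\<^sup>2) + (\<Sum>r\<le>n. v r * v (r + 2)))"
    by (rule autocorrelation_inequality) (auto simp: v_def)
  hence "2 * t * (binom_corr t 1 n)\<^sup>2
       < binom_corr t 0 n * (binom_corr t 0 n + t * binom_corr t 2 n)"
    unfolding corr using corr[of 0] by (simp add: power2_eq_square x algebra_simps flip: x)
  thus ?thesis
    unfolding binom_corr_0_Suc binom_corr_1_Suc by (simp add: power2_eq_square algebra_simps)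
qed

section \<open>Expectations under the binomial distribution\<close>

definition binom_weight :: "nat \<Rightarrow> real \<Rightarrow> nat \<Rightarrow> real" where
  "binom_weight n q r = real (n choose r) * q ^ r * (1 - q) ^ (n - r)"

definition binom_expect :: "nat \<Rightarrow> real \<Rightarrow> (nat \<Rightarrow> real) \<Rightarrow> real" where
  "binom_expect n q h = (\<Sum>r\<le>n. binom_weight n q r * h r)"

lemma binom_weight_nonneg: "0 \<le> q \<Longrightarrow> q \<le> 1 \<Longrightarrow> binom_weight n q r \<ge> 0"
  by (simp add: binom_weight_def)

text \<open>
  In terms of the odds \<open>q / (1 - q)\<close> the exponent no longer involves \<open>n - r\<close>, so that
  products of weights of two coins collapse to powers of the product of the odds.
\<close>

lemma binom_weight_odds:
  assumes "q < 1"
  shows "binom_weight n q r = (1 - q) ^ n * (real (n choose r) * (q / (1 - q)) ^ r)"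
proof (cases "r \<le> n")
  case True
  thus ?thesis using assms by (simp add: binom_weight_def power_diff power_divide)
qed (simp add: binom_weight_def)

text \<open>
  The last toss is heads or tails. The identity survives \<open>r \<ge> n\<close>, where the truncated
  subtraction in the exponent is harmless since the binomial coefficient vanishes.
\<close>

lemma binom_weight_Suc_Suc:
  "binom_weight (Suc n) q (Suc r) = q * binom_weight n q r + (1 - q) * binom_weight n q (Suc r)"
proof (cases "r < n")
  case True
  hence "(1 - q) * (1 - q) ^ (n - Suc r) = (1 - q) ^ (n - r)"
    by (metis Suc_diff_Suc power_Suc)
  hence miss: "(1 - q) * binom_weight n q (Suc r)
      = real (n choose Suc r) * q ^ Suc r * (1 - q) ^ (n - r)"
    by (simp add: binom_weight_def)
  show ?thesis unfolding miss by (simp add: binom_weight_def algebra_simps)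
qed (simp add: binom_weight_def algebra_simps)

lemma binom_expect_mono:
  assumes "0 \<le> q" "q \<le> 1" "\<And>r. g r \<le> h r"
  shows "binom_expect n q g \<le> binom_expect n q h"
  unfolding binom_expect_def
  by (intro sum_mono mult_left_mono assms binom_weight_nonneg)

lemma binom_expect_add: "binom_expect n q (\<lambda>r. g r + h r) = binom_expect n q g + binom_expect n q h"
  by (simp add: binom_expect_def sum.distrib algebra_simps)

lemma binom_expect_diff: "binom_expect n q (\<lambda>r. g r - h r) = binom_expect n q g - binom_expect n q h"
  by (simp add: binom_expect_def sum_subtractf algebra_simps)

lemma binom_expect_cmult: "binom_expect n q (\<lambda>r. c * h r) = c * binom_expect n q h"
  by (simp add: binom_expect_def sum_distrib_left algebra_simps)

text \<open>
  Conditioning on one toss turns a step in \<open>n\<close> into a change of the integrand; for indicator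
  functions this replaces manipulations of tail sums.
\<close>

lemma binom_expect_Suc:
  "binom_expect (Suc n) q h = binom_expect n q (\<lambda>r. q * h (Suc r) + (1 - q) * h r)"
proof -
  have weight_0: "binom_weight (Suc n) q 0 = (1 - q) * binom_weight n q 0"
    by (simp add: binom_weight_def)
  have "binom_expect (Suc n) q h = (1 - q) * (binom_weight n q 0 * h 0)
      + (\<Sum>r\<le>n. q * (binom_weight n q r * h (Suc r)))
      + (1 - q) * (\<Sum>r\<le>n. binom_weight n q (Suc r) * h (Suc r))"
    unfolding binom_expect_def sum.atMost_Suc_shift[of _ n] binom_weight_Suc_Suc weight_0
    by (simp add: sum.distrib sum_subtractf sum_distrib_left algebra_simps)
  also have "(\<Sum>r\<le>n. binom_weight n q (Suc r) * h (Suc r))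
      = binom_expect n q h - binom_weight n q 0 * h 0"
    using sum_atMost_shift_vanishing[of "\<lambda>r. binom_weight n q r * h r" n]
    by (simp add: binom_weight_def binom_expect_def)
  finally show ?thesis
    by (simp add: binom_expect_def sum.distrib sum_subtractf sum_distrib_left algebra_simps)
qed

lemma binom_expect_power: "binom_expect n q (\<lambda>r. y ^ r) = (q * y + (1 - q)) ^ n"
proof (induction n)
  case 0
  show ?case by (simp add: binom_expect_def binom_weight_def)
next
  case (Suc n)
  have "binom_expect (Suc n) q (\<lambda>r. y ^ r) = binom_expect n q (\<lambda>r. (q * y + (1 - q)) * y ^ r)"
    unfolding binom_expect_Suc by (simp add: algebra_simps)
  thus ?case by (simp add: binom_expect_cmult Suc)
qed

lemma binom_expect_point: "binom_expect n q (\<lambda>s. of_bool (s = r)) = binom_weight n q r"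
  by (cases "r \<le> n")
     (auto simp: binom_expect_def of_bool_def if_distrib sum.delta binom_weight_def cong: if_cong)

section \<open>Increments of the winning probability and its decay\<close>

lemma f_eq_expect: "f n p q = binom_expect n p (\<lambda>r. binom_expect n q (\<lambda>s. of_bool (r < s)))"
proof -
  have "(\<Sum>s\<in>{r<..n}. binom_weight n q s) = binom_expect n q (\<lambda>s. of_bool (r < s))" for r
    unfolding binom_expect_def by (rule sum.mono_neutral_cong_left) auto
  thus ?thesis
    unfolding f_def binom_weight_def[symmetric] by (simp add: binom_expect_def)
qed

text \<open>
  Condition on one round of tosses for both players. If both or neither get heads, the comparison
  is unaffected. If only Alice does, a tie turns into a win for her; if only Bob
  does, a lead of one for Alice is lost.
\<close>

lemma f_increment:
  "f (Suc n) p q - f n p q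
     = q * (1 - p) * (\<Sum>r\<le>n. binom_weight n p r * binom_weight n q r)
     - p * (1 - q) * (\<Sum>r\<le>n. binom_weight n p r * binom_weight n q (Suc r))"
proof -
  \<comment> \<open>Bob alone scores (first equation) or Alice alone scores (second equation).\<close>
  have split: "(of_bool (Suc r < s) :: real) = of_bool (r < s) - of_bool (s = Suc r)"
    "(of_bool (r < Suc s) :: real) = of_bool (r < s) + of_bool (s = r)" for r s
    by (auto simp: of_bool_def)
  have "f (Suc n) p q = binom_expect n p (\<lambda>r. binom_expect n q (\<lambda>s. of_bool (r < s))
      + q * (1 - p) * binom_weight n q r - p * (1 - q) * binom_weight n q (Suc r))"
    unfolding f_eq_expect binom_expect_Suc
    by (simp only: Suc_less_eq split binom_expect_add binom_expect_diff binom_expect_cmult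
        binom_expect_point)
       (simp add: algebra_simps binom_expect_add binom_expect_diff binom_expect_cmult)
  thus ?thesis
    unfolding f_eq_expect binom_expect_add binom_expect_diff binom_expect_cmult
    by (simp add: binom_expect_def)
qed

lemma f_increment_binom_corr:
  assumes "p < 1" "q < 1"
  defines "t \<equiv> p / (1 - p) * (q / (1 - q))"
  shows "f (Suc n) p q - f n p q = ((1 - p) * (1 - q)) ^ n *
    (q * (1 - p) * binom_corr t 0 n - p * q * binom_corr t 1 n)"
proof -
  have t_power: "t ^ r = (p / (1 - p)) ^ r * (q / (1 - q)) ^ r" for r
    by (simp only: t_def power_mult_distrib)
  have corr: "(\<Sum>r\<le>n. binom_weight n p r * binom_weight n q (r + k))
      = ((1 - p) * (1 - q)) ^ n * (q / (1 - q)) ^ k * binom_corr t k n" for k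
    unfolding binom_weight_odds[OF assms(1)] binom_weight_odds[OF assms(2)]
    by (simp add: binom_corr_def t_power sum_distrib_left power_mult_distrib power_add mult_ac)
  have corr_0: "(\<Sum>r\<le>n. binom_weight n p r * binom_weight n q r)
      = ((1 - p) * (1 - q)) ^ n * binom_corr t 0 n"
    using corr[of 0] by simp
  have "(1 - q) * (\<Sum>r\<le>n. binom_weight n p r * binom_weight n q (Suc r))
      = ((1 - p) * (1 - q)) ^ n * (q * binom_corr t 1 n)"
    using corr[of 1] assms(2) by simp
  hence corr_1: "p * (1 - q) * (\<Sum>r\<le>n. binom_weight n p r * binom_weight n q (Suc r))
      = p * (((1 - p) * (1 - q)) ^ n * (q * binom_corr t 1 n))"
    by (simp only: mult.assoc)
  have factor: "q * (1 - p) * (K * x) - p * (K * (q * y)) = K * (q * (1 - p) * x - p * q * y)"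
    for K x y :: real
    by (simp add: algebra_simps)
  show ?thesis
    unfolding f_increment corr_0 corr_1 by (rule factor)
qed

text \<open>
  The Chernoff method: for \<open>z \<ge> 1\<close> the indicator of \<open>r < s\<close> is at most \<open>z\<close> to the power
  \<open>s - r\<close>, whose expectation factors over independent tosses.
\<close>

lemma f_chernoff_bound:
  assumes "0 < q" "q < 1" "0 < p" "p < 1" "z \<ge> 1"
  shows "f n p q \<le> ((q * z + (1 - q)) * (p / z + (1 - p))) ^ n"
proof -
  have "of_bool (r < s) \<le> (1 / z) ^ r * z ^ s" for r s
  proof (cases "r < s")
    case True
    hence "z ^ r \<le> z ^ s" using assms by (intro power_increasing) auto
    thus ?thesis using assms by (simp add: power_divide)
  qed (use assms in simp)
  hence "f n p q \<le> binom_expect n p (\<lambda>r. binom_expect n q (\<lambda>s. (1 / z) ^ r * z ^ s))"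
    unfolding f_eq_expect using assms by (intro binom_expect_mono) auto
  also have "\<dots> = binom_expect n p (\<lambda>r. (q * z + (1 - q)) ^ n * (1 / z) ^ r)"
    unfolding binom_expect_cmult[of n q] binom_expect_power by (simp only: mult.commute)
  also have "\<dots> = ((q * z + (1 - q)) * (p / z + (1 - p))) ^ n"
    by (simp add: binom_expect_cmult binom_expect_power power_mult_distrib
        del: power_divide power_one_over)
  finally show ?thesis .
qed

lemma f_tendsto_0:
  assumes "0 < q" "q < p" "p < 1"
  shows "(\<lambda>n. f n p q) \<longlonglongrightarrow> 0"
proof -
  define a b where "a = q * (1 - p)" and "b = p * (1 - q)"
  have ab: "0 < a" "a < b" using assms by (auto simp: a_def b_def algebra_simps)
  \<comment> \<open>This \<open>z\<close> minimises \<open>a * z + b / z\<close>, the part of the Chernoff base that depends on \<open>z\<close>.\<close>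
  define z where "z = sqrt (b / a)"
  have z: "z > 1" "z * z = b / a" using ab by (auto simp: z_def)
  define \<rho> where "\<rho> = (q * z + (1 - q)) * (p / z + (1 - p))"
  have "1 - \<rho> = (z - 1) * (b / z - a)"
  proof -
    have "\<rho> = p * q + (1 - q) * (1 - p) + a * z + b / z"
      using z(1) by (simp add: \<rho>_def a_def b_def algebra_simps diff_divide_distrib)
    moreover have "p * q + (1 - q) * (1 - p) = 1 - a - b"
      by (simp add: a_def b_def algebra_simps)
    moreover have "(z - 1) * (b / z - a) = b - a * z - b / z + a"
    proof -
      have "z * (b / z) = b" using z(1) by simp
      thus ?thesis by (simp only: left_diff_distrib right_diff_distrib) (simp add: mult.commute)
    qed
    ultimately show ?thesis by linarith
  qed
  also have "b / z = a * z"
  proof -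
    have "b = (a * z) * z" using ab(1) by (simp add: mult.assoc z(2))
    thus ?thesis using z(1) by (metis nonzero_mult_div_cancel_right not_one_less_zero)
  qed
  also have "(z - 1) * (a * z - a) = a * (z - 1)\<^sup>2"
    by (simp add: power2_eq_square algebra_simps)
  finally have "1 - \<rho> = a * (z - 1)\<^sup>2" .
  moreover have "a * (z - 1)\<^sup>2 > 0" using ab(1) z(1) by simp
  ultimately have "\<rho> < 1" by linarith
  moreover have "\<rho> \<ge> 0" using assms z(1) unfolding \<rho>_def
    by (intro mult_nonneg_nonneg add_nonneg_nonneg) auto
  ultimately have lim: "(\<lambda>n. \<rho> ^ n) \<longlonglongrightarrow> 0" by (intro LIMSEQ_realpow_zero)
  have upper: "f n p q \<le> \<rho> ^ n" for n
    unfolding \<rho>_def using assms z(1) by (intro f_chernoff_bound) auto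
  have lower: "f n p q \<ge> 0" for n
    unfolding f_def using assms by (intro sum_nonneg mult_nonneg_nonneg) auto
  show ?thesis
    by (rule tendsto_sandwich[OF always_eventually always_eventually tendsto_const lim])
       (intro allI lower upper)+
qed

section \<open>Unimodality\<close>

text \<open>
  The first index \<open>m\<close> at which \<open>g\<close> fails to increase is a peak, since \<open>start\<close> gives
  \<open>m \<ge> 1\<close>. By \<open>persist\<close>, \<open>g\<close> decreases strictly from \<open>m + 1\<close> on, so \<open>m + 1\<close> is the only
  other candidate, and it is a peak exactly when \<open>g (m + 1) = g m\<close>.
\<close>

lemma peaks_of_single_sign_change:
  fixes g :: "nat \<Rightarrow> real"
  assumes start: "g 0 < g 1"
    and persist: "\<And>n. g (n + 1) \<le> g n \<Longrightarrow> g (n + 2) < g (n + 1)"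
    and turn: "g (k + 1) \<le> g k"
  defines "S \<equiv> {n. n \<ge> 1 \<and> g n \<ge> g (n - 1) \<and> g (n + 1) \<le> g n
      \<and> (g n > g (n - 1) \<or> g (n + 1) < g n)}"
  shows "(\<exists>m. S = {m}) \<or> (\<exists>m. S = {m, m + 1})"
proof -
  define m where "m = (LEAST n. g (n + 1) \<le> g n)"
  have m: "g (m + 1) \<le> g m" unfolding m_def by (rule LeastI[of _ k]) (fact turn)
  have rise: "g n < g (n + 1)" if "n < m" for n
    using not_less_Least[of n "\<lambda>n. g (n + 1) \<le> g n"] that by (simp add: m_def not_le)
  have "m \<noteq> 0" using m start by (cases "m = 0") auto
  have fall: "g (n + 1) < g n" if "m < n" for n
    using that
  proof (induction n rule: less_induct)
    case (less n)
    then obtain j where j: "n = j + 1" by (metis less_natE Suc_eq_plus1)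
    have "g (j + 1) \<le> g j" using less j m by (cases "j = m") (auto simp: less_imp_le)
    thus ?case using persist[of j] j by simp
  qed
  have S_iff: "n \<in> S \<longleftrightarrow> n = m \<or> n = m + 1 \<and> g (m + 1) = g m" for n
  proof -
    consider "n < m" | "n = m" | "n = m + 1" | "n > m + 1" by linarith
    thus ?thesis
    proof cases
      case 1
      thus ?thesis using rise[of n] by (auto simp: S_def)
    next
      case 2
      thus ?thesis using rise[of "m - 1"] m \<open>m \<noteq> 0\<close> by (auto simp: S_def)
    next
      case 3
      thus ?thesis using fall[of n] m by (auto simp: S_def)
    next
      case 4
      hence "m < n - 1" by linarith
      thus ?thesis using fall[of "n - 1"] by (auto simp: S_def)
    qed
  qed
  show ?thesis
  proof (cases "g (m + 1) = g m")
    case True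
    hence "S = {m, m + 1}" using S_iff by auto
    thus ?thesis by blast
  next
    case False
    hence "S = {m}" using S_iff by auto
    thus ?thesis by blast
  qed
qed

theorem theorem2:
  fixes p q :: real
  assumes "0 < q" and "q < p" and "p < 1" and "p + q \<noteq> 1"
  defines "S \<equiv> {n :: nat. n \<ge> 1 \<and>
      f n p q \<ge> f (n - 1) p q \<and>
      f (n + 1) p q \<le> f n p q \<and>
      (f n p q > f (n - 1) p q \<or> f (n + 1) p q < f n p q)}"
  shows "(\<exists>m. S = {m}) \<or> (\<exists>m. S = {m, m + 1})"
proof -
  define t where "t = p / (1 - p) * (q / (1 - q))"
  \<comment> \<open>The increment of \<open>f\<close> without its positive factor that depends on \<open>n\<close>.\<close>
  define d where "d n = q * (1 - p) * binom_corr t 0 n - p * q * binom_corr t 1 n" for n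
  have "t > 0" using assms by (simp add: t_def)
  have increment: "f (n + 1) p q - f n p q = ((1 - p) * (1 - q)) ^ n * d n" for n
    using f_increment_binom_corr[of p q n] assms by (simp add: d_def t_def)
  have scale: "((1 - p) * (1 - q)) ^ n > 0" for n using assms by simp
  have step: "f (n + 1) p q \<le> f n p q \<longleftrightarrow> d n \<le> 0" "f (n + 1) p q < f n p q \<longleftrightarrow> d n < 0" for n
    using increment[of n] scale[of n] by (smt (verit) zero_less_mult_iff mult_less_0_iff)+
  have "f 1 p q - f 0 p q = q * (1 - p)"
    using increment[of 0] by (simp add: d_def binom_corr_def)
  moreover have "q * (1 - p) > 0" using assms by simp
  ultimately have start: "f 0 p q < f 1 p q" by linarith
  have persist: "f (n + 2) p q < f (n + 1) p q" if "f (n + 1) p q \<le> f n p q" for n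
  proof -
    have pos: "binom_corr t 0 n > 0" "binom_corr t 0 (Suc n) > 0"
      using \<open>t > 0\<close> by (simp_all add: binom_corr_0_pos)
    have "q * (1 - p) * binom_corr t 0 n \<le> p * q * binom_corr t 1 n"
      using that unfolding step d_def by simp
    \<comment> \<open>A nonpositive increment bounds the ratio below, and the ratio increases strictly.\<close>
    hence "q * (1 - p) * binom_corr t 0 n * binom_corr t 0 (Suc n)
        \<le> p * q * binom_corr t 1 n * binom_corr t 0 (Suc n)"
      using pos by (intro mult_right_mono) auto
    also have "\<dots> < p * q * (binom_corr t 1 (Suc n) * binom_corr t 0 n)"
      using binom_corr_ratio_strict_mono[OF \<open>t > 0\<close>, of n] assms by (simp add: mult.assoc)
    finally have "binom_corr t 0 n * (q * (1 - p) * binom_corr t 0 (Suc n))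
        < binom_corr t 0 n * (p * q * binom_corr t 1 (Suc n))"
      by (simp only: mult_ac)
    hence "d (Suc n) < 0" using pos by (simp add: d_def mult_less_cancel_left_pos)
    thus ?thesis using step(2)[of "Suc n"] by simp
  qed
  obtain k where turn: "f (k + 1) p q \<le> f k p q"
  proof (rule ccontr)
    assume "\<not> thesis"
    hence "\<not> f (Suc k) p q \<le> f k p q" for k using that[of k] by (simp only: Suc_eq_plus1) blast
    hence "incseq (\<lambda>n. f n p q)" by (intro incseq_SucI less_imp_le) (simp only: not_le)
    hence "f 1 p q \<le> 0" using f_tendsto_0[of q p] assms by (intro incseq_le) auto
    moreover have "f 0 p q = 0" by (simp add: f_def)
    ultimately show False using start by simp
  qed
  show ?thesis
    unfolding S_def by (rule peaks_of_single_sign_change[OF start persist turn])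
qed

end
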